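(* For any bivariate copula $C$ we have $$\max\big\{\tfrac43\phi(C)-\tfrac13,\ -\tfrac23\phi(C)+\gamma(C)-\tfrac13\big\}\le\tau(C)\le\min\big\{\tfrac23\phi(C)+\tfrac13,\ -\tfrac43\phi(C)+2\gamma(C)+\tfrac13\big\}.$$
   Context: Let $\mathbb{I}=[0,1]$. A (bivariate) copula is a function $C:\mathbb{I}^2\to\mathbb{I}$ with $C(0,v)=C(u,0)=0$, $C(u,1)=u$, $C(1,v)=v$ for all $u,v\in\mathbb{I}$, and $C(u_2,v_2)-C(u_2,v_1)-C(u_1,v_2)+C(u_1,v_1)\ge 0$ whenever $u_1\le u_2$, $v_1\le v_2$ in $\mathbb{I}$. Each copula induces a Borel probability measure $\mu_C$ on $\mathbb{I}^2$ with $\mu_C([0,u]\times[0,v])=C(u,v)$; integration against it is written $dC(u,v)$. For a copula $C$: Kendall's tau is $\tau(C)=4\int_{\mathbb{I}^2}C(u,v)\,dC(u,v)-1$; Gini's gamma is $\gamma(C)=4\int_0^1 C(u,u)\,du+4\int_0^1 C(u,1-u)\,du-2$; Spearman's footrule is $\phi(C)=6\int_0^1 C(u,u)\,du-2$. *)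

theory Defs
  imports "HOL-Probability.Probability"
begin

text \<open>Copulas are total functions on the plane; only their values on the unit square matter.\<close>

definition copula :: "(real \<Rightarrow> real \<Rightarrow> real) \<Rightarrow> bool" where
  "copula C \<longleftrightarrow>
     (\<forall>u\<in>{0..1}. \<forall>v\<in>{0..1}. C u v \<in> {0..1}) \<and>
     (\<forall>v\<in>{0..1}. C 0 v = 0) \<and> (\<forall>u\<in>{0..1}. C u 0 = 0) \<and>
     (\<forall>u\<in>{0..1}. C u 1 = u) \<and> (\<forall>v\<in>{0..1}. C 1 v = v) \<and>
     (\<forall>u1\<in>{0..1}. \<forall>u2\<in>{0..1}. \<forall>v1\<in>{0..1}. \<forall>v2\<in>{0..1}.
        u1 \<le> u2 \<longrightarrow> v1 \<le> v2 \<longrightarrow> C u2 v2 - C u2 v1 - C u1 v2 + C u1 v1 \<ge> 0)"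

text \<open>
  The Borel probability measure on the unit square whose distribution function is \<open>C\<close>.
  For a copula it exists (Lebesgue--Stieltjes construction) and is unique, because the anchored
  rectangles are closed under intersection and generate the Borel sets of the unit square.
\<close>

definition copula_measure :: "(real \<Rightarrow> real \<Rightarrow> real) \<Rightarrow> (real \<times> real) measure" where
  "copula_measure C = (THE M.
     sets M = sets (restrict_space borel ({0..1} \<times> {0..1})) \<and> prob_space M \<and>
     (\<forall>u\<in>{0..1}. \<forall>v\<in>{0..1}. measure M ({0..u} \<times> {0..v}) = C u v))"

definition kendall_tau :: "(real \<Rightarrow> real \<Rightarrow> real) \<Rightarrow> real" where
  "kendall_tau C = 4 * (LINT (u, v)|copula_measure C. C u v) - 1"

definition gini_gamma :: "(real \<Rightarrow> real \<Rightarrow> real) \<Rightarrow> real" where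
  "gini_gamma C =
     4 * (LINT u:{0..1}|lborel. C u u) + 4 * (LINT u:{0..1}|lborel. C u (1 - u)) - 2"

definition spearman_footrule :: "(real \<Rightarrow> real \<Rightarrow> real) \<Rightarrow> real" where
  "spearman_footrule C = 6 * (LINT u:{0..1}|lborel. C u u) - 2"

end

theory Submission
  imports Defs
begin

text \<open>
  Let \<open>(U, V)\<close> have distribution \<open>copula_measure C\<close>, and write \<open>T = E C(U, V)\<close>, \<open>a = \<integral> C(t, t) dt\<close>,
  \<open>b = \<integral> C(t, 1 - t) dt\<close>. The claim amounts to \<open>max (2a - 1/2) b \<le> T \<le> min a (2b)\<close>. The variables
  \<open>X = min U V\<close> and \<open>Y = min U (1 - V)\<close> have the continuous distribution functions
  \<open>F t = 2t - C(t, t)\<close> and \<open>G t = t + C(t, 1 - t)\<close> and the means \<open>a\<close> and \<open>1/2 - b\<close>, while \<open>F X\<close> and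
  \<open>G Y\<close> are uniform and so have mean \<open>1/2\<close>. Now integrate the pointwise bounds
  \<open>max (2X - F X) (U - Y) \<le> C(U, V) \<le> min X (U - 2Y + G Y)\<close>.

  The measure itself is obtained from the conditional distribution functions of \<open>V\<close> given \<open>U\<close>,
  which are Radon--Nikodym derivatives of \<open>u \<mapsto> C(u, q)\<close> for rational \<open>q\<close>: with \<open>U, W\<close> independent
  and uniform, \<open>V\<close> is the conditional quantile of \<open>U\<close> at level \<open>W\<close>.
\<close>

subsection \<open>Stieltjes measures on the unit interval\<close>

text \<open>The total mass \<open>F 1\<close> is left free: the sections
  \<open>u \<mapsto> C u q\<close> of a copula have mass \<open>q\<close>, and differences of such
  sections are needed as well.\<close>

definition continuous_cdf_on_unit :: "(real \<Rightarrow> real) \<Rightarrow> bool" where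
  "continuous_cdf_on_unit F \<longleftrightarrow>
     mono F \<and> continuous_on UNIV F \<and> (\<forall>x\<le>0. F x = 0) \<and> (\<forall>x>1. F x = F 1)"

lemma continuous_cdf_on_unit_nonneg:
  assumes "continuous_cdf_on_unit F"
  shows "0 \<le> F x"
  using assms unfolding continuous_cdf_on_unit_def mono_def by (metis linear)

lemma continuous_cdf_on_unit_zero: "continuous_cdf_on_unit (\<lambda>_. 0)"
  by (simp add: continuous_cdf_on_unit_def mono_def)

lemma
  assumes "continuous_cdf_on_unit F"
  shows finite_borel_measure_interval_measure_unit: "finite_borel_measure (interval_measure F)"
    and emeasure_interval_measure_UNIV_unit: "emeasure (interval_measure F) UNIV = F 1"
proof -
  have mono: "F x \<le> F y" if "x \<le> y" for x y
    using assms that by (auto simp: continuous_cdf_on_unit_def mono_def)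
  have cont: "continuous (at_right a) F" for a
    using assms by (auto simp: continuous_cdf_on_unit_def continuous_on_eq_continuous_at
        intro: continuous_at_imp_continuous_at_within)
  have bot: "(F \<longlongrightarrow> 0) at_bot"
    using assms by (intro tendsto_eventually)
      (auto simp: continuous_cdf_on_unit_def eventually_at_bot_linorder)
  have top: "(F \<longlongrightarrow> F 1) at_top"
    using assms by (intro tendsto_eventually)
      (auto simp: continuous_cdf_on_unit_def eventually_at_top_dense)
  note props = mono cont bot top continuous_cdf_on_unit_nonneg[OF assms]
  show "finite_borel_measure (interval_measure F)"
    by (rule finite_borel_measure_interval_measure[OF props])
  show "emeasure (interval_measure F) UNIV = F 1"
    by (rule interval_measure_UNIV[OF props])
qed

text \<open>For \<open>y \<le> 0\<close> the interval \<open>{y<..x}\<close> already carries the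
  mass \<open>F x\<close>, and the value of the cdf at \<open>y\<close> vanishes in the limit at
  \<open>at_bot\<close>.\<close>

lemma cdf_interval_measure_unit:
  assumes "continuous_cdf_on_unit F"
  shows "cdf (interval_measure F) x = F x"
proof -
  interpret finite_borel_measure "interval_measure F"
    using finite_borel_measure_interval_measure_unit[OF assms] .
  have "cdf (interval_measure F) x - cdf (interval_measure F) y = F x"
    if "y < x" "y \<le> 0" for y
  proof -
    have "cdf (interval_measure F) x - cdf (interval_measure F) y = measure (interval_measure F) {y<..x}"
      using cdf_diff_eq that by simp
    also have "\<dots> = F x - F y"
      using assms that
      by (intro measure_interval_measure_Ioc)
         (auto simp: continuous_cdf_on_unit_def mono_def continuous_on_eq_continuous_at
            intro: continuous_at_imp_continuous_at_within)
    finally show ?thesis using assms that by (auto simp: continuous_cdf_on_unit_def)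
  qed
  then have "\<forall>\<^sub>F y in at_bot. cdf (interval_measure F) x - cdf (interval_measure F) y = F x"
    using eventually_conj[OF eventually_gt_at_bot[of x] eventually_le_at_bot[of 0]]
    by (auto elim: eventually_mono)
  then have "((\<lambda>y. cdf (interval_measure F) x - cdf (interval_measure F) y) \<longlongrightarrow> F x) at_bot"
    by (rule tendsto_eventually)
  moreover have "((\<lambda>y. cdf (interval_measure F) x - cdf (interval_measure F) y)
      \<longlongrightarrow> cdf (interval_measure F) x - 0) at_bot"
    by (intro tendsto_intros cdf_lim_at_bot)
  ultimately show ?thesis
    using tendsto_unique[OF trivial_limit_at_bot_linorder] by fastforce
qed

lemma emeasure_interval_measure_atMost_unit:
  assumes "continuous_cdf_on_unit F"
  shows "emeasure (interval_measure F) {..x} = F x"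
proof -
  interpret finite_borel_measure "interval_measure F"
    using finite_borel_measure_interval_measure_unit[OF assms] .
  show ?thesis
    using cdf_interval_measure_unit[OF assms, of x] by (simp add: cdf_def emeasure_eq_measure)
qed

text \<open>A finite Borel measure on the line is determined by its cdf, so the setwise sum, once
  known to be a measure, is the Stieltjes measure of \<open>F + G\<close>. Applied to
  \<open>F\<close> and \<open>G - F\<close>, this shows that one Stieltjes measure dominates
  another.\<close>

lemma emeasure_interval_measure_add:
  assumes F: "continuous_cdf_on_unit F" and G: "continuous_cdf_on_unit G"
    and A: "A \<in> sets borel"
  shows "emeasure (interval_measure (\<lambda>x. F x + G x)) A =
    emeasure (interval_measure F) A + emeasure (interval_measure G) A"
proof -
  let ?S = "\<lambda>A. emeasure (interval_measure F) A + emeasure (interval_measure G) A"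
  define N where "N = measure_of UNIV (sets borel) ?S"
  have FG: "continuous_cdf_on_unit (\<lambda>x. F x + G x)"
    using F G unfolding continuous_cdf_on_unit_def mono_def
    by (intro conjI allI impI add_mono continuous_on_add) simp_all
  interpret F: finite_borel_measure "interval_measure F"
    using finite_borel_measure_interval_measure_unit[OF F] .
  interpret G: finite_borel_measure "interval_measure G"
    using finite_borel_measure_interval_measure_unit[OF G] .
  have sigma: "sigma_algebra UNIV (sets (borel :: real measure))"
    using sets.sigma_algebra_axioms[of "borel :: real measure"] by simp
  have sets_N: "sets N = sets borel"
    unfolding N_def using sigma_algebra.sets_measure_of_eq[OF sigma] by simp
  have emeasure_N: "emeasure N B = ?S B" if "B \<in> sets borel" for B
    unfolding N_def
  proof (rule emeasure_measure_of_sigma[OF sigma _ _ that])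
    show "positive (sets borel) ?S" by (simp add: positive_def)
    show "countably_additive (sets borel) ?S"
      unfolding countably_additive_def
    proof safe
      fix B :: "nat \<Rightarrow> real set"
      assume B: "range B \<subseteq> sets borel" "disjoint_family B"
      show "(\<Sum>i. ?S (B i)) = ?S (\<Union>i. B i)"
        using B by (simp add: suminf_add[symmetric] suminf_emeasure)
    qed
  qed
  have "finite_borel_measure N"
  proof (intro finite_borel_measure.intro finite_borel_measure_axioms.intro finite_measureI)
    have "space N = UNIV" using sets_eq_imp_space_eq[OF sets_N] by simp
    then show "emeasure N (space N) \<noteq> \<infinity>"
      using emeasure_N[of UNIV] F.emeasure_finite[of UNIV] G.emeasure_finite[of UNIV]
      by simp
  qed (rule sets_N)
  moreover have "cdf N = cdf (interval_measure (\<lambda>x. F x + G x))"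
  proof
    fix x
    have "emeasure N {..x} = ennreal (F x + G x)"
      using emeasure_N[of "{..x}"] F G
      by (simp add: emeasure_interval_measure_atMost_unit continuous_cdf_on_unit_nonneg)
    then have "cdf N x = F x + G x"
      using F G by (simp add: cdf_def measure_def continuous_cdf_on_unit_nonneg del: ennreal_plus)
    then show "cdf N x = cdf (interval_measure (\<lambda>x. F x + G x)) x"
      using cdf_interval_measure_unit[OF FG] by simp
  qed
  ultimately have "N = interval_measure (\<lambda>x. F x + G x)"
    using cdf_unique' finite_borel_measure_interval_measure_unit[OF FG] by blast
  then show ?thesis using emeasure_N[OF A] by simp
qed

text \<open>Let \<open>d\<close> be the density of the measure of \<open>G - F\<close>. Then
  \<open>f + d\<close> and \<open>g\<close> are both densities of the measure of \<open>G\<close>,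
  so they agree almost everywhere, and \<open>d\<close> is nonnegative.\<close>

lemma interval_measure_density_mono:
  assumes F: "continuous_cdf_on_unit F" and G: "continuous_cdf_on_unit G"
    and GF: "continuous_cdf_on_unit (\<lambda>x. G x - F x)"
    and H: "continuous_cdf_on_unit H" and HG: "continuous_cdf_on_unit (\<lambda>x. H x - G x)"
    and f[measurable]: "f \<in> borel_measurable borel" "density (interval_measure H) f = interval_measure F"
    and g[measurable]: "g \<in> borel_measurable borel" "density (interval_measure H) g = interval_measure G"
  shows "AE x in interval_measure H. f x \<le> g x"
proof -
  interpret H: finite_borel_measure "interval_measure H"
    using finite_borel_measure_interval_measure_unit[OF H] .
  \<comment> \<open>This function is \<open>(H - G) + F\<close>. That it is a cdf makes the measure
    of \<open>G - F\<close> dominated by that of \<open>H\<close>, hence absolutely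
    continuous.\<close>
  have HD: "continuous_cdf_on_unit (\<lambda>x. H x - (G x - F x))"
    unfolding continuous_cdf_on_unit_def
  proof (intro conjI allI impI)
    show "mono (\<lambda>x. H x - (G x - F x))"
    proof (rule monoI)
      fix x y :: real assume "x \<le> y"
      then have "H x - G x \<le> H y - G y" "F x \<le> F y"
        using HG F by (auto simp: continuous_cdf_on_unit_def mono_def)
      then show "H x - (G x - F x) \<le> H y - (G y - F y)" by linarith
    qed
    show "continuous_on UNIV (\<lambda>x. H x - (G x - F x))"
      using H GF unfolding continuous_cdf_on_unit_def by (auto intro: continuous_on_diff[of UNIV H "\<lambda>x. G x - F x"])
    show "H x - (G x - F x) = 0" if "x \<le> 0" for x
      using H GF that unfolding continuous_cdf_on_unit_def by simp
    show "H x - (G x - F x) = H 1 - (G 1 - F 1)" if "1 < x" for x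
      using H GF that unfolding continuous_cdf_on_unit_def by simp
  qed
  have "\<exists>d\<in>borel_measurable (interval_measure H).
      density (interval_measure H) d = interval_measure (\<lambda>x. G x - F x)"
  proof (rule H.Radon_Nikodym)
    have "emeasure (interval_measure (\<lambda>x. G x - F x)) A \<le> emeasure (interval_measure H) A"
      if "A \<in> sets borel" for A
      using emeasure_interval_measure_add[OF HD GF that] by (simp add: add_increasing)
    then show "absolutely_continuous (interval_measure H) (interval_measure (\<lambda>x. G x - F x))"
      unfolding absolutely_continuous_def null_sets_def by auto (metis le_zero_eq)
  qed simp
  then obtain d where d[measurable]: "d \<in> borel_measurable borel"
    and dd: "density (interval_measure H) d = interval_measure (\<lambda>x. G x - F x)"
    by (auto simp: measurable_cong_sets[OF sets_interval_measure refl])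
  have "density (interval_measure H) (\<lambda>x. f x + d x) = density (interval_measure H) g"
  proof (rule measure_eqI)
    fix A assume "A \<in> sets (density (interval_measure H) (\<lambda>x. f x + d x))"
    then have A[measurable]: "A \<in> sets borel" by simp
    have "emeasure (density (interval_measure H) (\<lambda>x. f x + d x)) A =
        emeasure (density (interval_measure H) f) A + emeasure (density (interval_measure H) d) A"
      by (simp add: emeasure_density distrib_right nn_integral_add)
    also have "\<dots> = emeasure (interval_measure (\<lambda>x. F x + (G x - F x))) A"
      unfolding f dd using emeasure_interval_measure_add[OF F GF A] by simp
    also have "\<dots> = emeasure (density (interval_measure H) g) A"
      unfolding g by simp
    finally show "emeasure (density (interval_measure H) (\<lambda>x. f x + d x)) A = \<dots>" .
  qed simp
  then have "AE x in interval_measure H. f x + d x = g x"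
    by (subst (asm) H.density_unique_iff) auto
  then show ?thesis by eventually_elim (metis add.right_neutral add_left_mono zero_le)
qed

text \<open>Retraction of the line onto the unit interval. It extends functions on the interval by
  constants, and it turns a real coordinate into a variable with values in the interval.\<close>

definition unit_clip :: "real \<Rightarrow> real" where
  "unit_clip x = max 0 (min 1 x)"

lemma unit_clip_mem [simp]: "unit_clip x \<in> {0..1}" "0 \<le> unit_clip x" "unit_clip x \<le> 1"
  by (auto simp: unit_clip_def)

lemma unit_clip_id: "x \<in> {0..1} \<Longrightarrow> unit_clip x = x"
  by (auto simp: unit_clip_def)

lemma unit_clip_mono: "x \<le> y \<Longrightarrow> unit_clip x \<le> unit_clip y"
  by (auto simp: unit_clip_def)

lemma continuous_on_unit_clip [continuous_intros]: "continuous_on S unit_clip"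
  unfolding unit_clip_def by (intro continuous_intros)

lemma measurable_unit_clip [measurable]: "unit_clip \<in> borel_measurable borel"
  by (intro borel_measurable_continuous_onI continuous_intros)

lemma interval_measure_unit_clip_le:
  assumes F: "continuous_cdf_on_unit F" and u: "u \<in> {0..1}"
  shows "emeasure (interval_measure F) {x. unit_clip x \<le> u} = F u"
proof (cases "u = 1")
  \<comment> \<open>Every real is clipped to a value at most \<open>1\<close>, so the set is the
    whole line instead of \<open>{..u}\<close>.\<close>
  case True
  then show ?thesis using emeasure_interval_measure_UNIV_unit[OF F] by simp
next
  case False
  with u have "{x. unit_clip x \<le> u} = {..u}" by (auto simp: unit_clip_def)
  then show ?thesis using emeasure_interval_measure_atMost_unit[OF F] by simp
qed

subsection \<open>Tail integrals and the probability integral transform\<close>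

lemma LINT_identity_unit: "(LINT t:{0..1}|lborel. t) = (1/2 :: real)"
  using integral_power[of 0 1 1] by (simp add: set_lebesgue_integral_def mult.commute)

text \<open>Fubini for the indicator of \<open>X z \<le> t\<close> with
  \<open>0 \<le> t \<le> 1\<close>: integration over \<open>t\<close> leaves \<open>1 - X z\<close>,
  integration over \<open>z\<close> leaves the cdf of \<open>X\<close> at \<open>t\<close>.\<close>

lemma (in prob_space) expectation_eq_one_minus_cdf_integral:
  fixes X :: "'a \<Rightarrow> real"
  assumes X [measurable]: "X \<in> borel_measurable M"
    and range: "\<And>z. z \<in> space M \<Longrightarrow> X z \<in> {0..1}"
  shows "expectation X = 1 - (LINT t:{0..1}|lborel. measure M {z \<in> space M. X z \<le> t})"
proof -
  interpret pair_sigma_finite M lborel ..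
  define S where "S = {p \<in> space (M \<Otimes>\<^sub>M lborel). X (fst p) \<le> snd p \<and> 0 \<le> snd p \<and> snd p \<le> 1}"
  define f where "f z t = (indicator S (z, t) :: real)" for z t
  have S [measurable]: "S \<in> sets (M \<Otimes>\<^sub>M lborel)"
    unfolding S_def by measurable
  have "emeasure (M \<Otimes>\<^sub>M lborel) S \<le> emeasure (M \<Otimes>\<^sub>M lborel) (space M \<times> {0..1::real})"
    by (rule emeasure_mono) (auto simp: S_def space_pair_measure)
  also have "\<dots> < \<infinity>"
    by (simp add: lborel.emeasure_pair_measure_Times emeasure_space_1)
  finally have "integrable (M \<Otimes>\<^sub>M lborel) (\<lambda>p. indicator S p :: real)"
    by (intro integrable_real_indicator S)
  then have Fubini: "(\<integral>t. (\<integral>z. f z t \<partial>M) \<partial>lborel) = (\<integral>z. (\<integral>t. f z t \<partial>lborel) \<partial>M)"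
    by (intro Fubini_integral) (simp add: f_def case_prod_beta')
  have "(\<integral>z. f z t \<partial>M) = indicator {0..1} t * measure M {z \<in> space M. X z \<le> t}" for t
  proof -
    have "(\<integral>z. f z t \<partial>M) = (\<integral>z. indicator {0..1} t * indicator {z \<in> space M. X z \<le> t} z \<partial>M)"
      by (rule Bochner_Integration.integral_cong)
        (auto simp: f_def S_def space_pair_measure indicator_def)
    then show ?thesis by simp
  qed
  moreover have "(\<integral>t. f z t \<partial>lborel) = 1 - X z" if z: "z \<in> space M" for z
  proof -
    have "(\<integral>t. f z t \<partial>lborel) = (\<integral>t. indicator {X z..1} t \<partial>lborel)"
      using z range[OF z]
      by (intro Bochner_Integration.integral_cong)
        (auto simp: f_def S_def space_pair_measure indicator_def)
    then show ?thesis using range[OF z] by simp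
  qed
  ultimately have "(LINT t:{0..1}|lborel. measure M {z \<in> space M. X z \<le> t}) = (\<integral>z. 1 - X z \<partial>M)"
    using Fubini by (simp add: set_lebesgue_integral_def cong: Bochner_Integration.integral_cong)
  also have "\<dots> = 1 - expectation X"
    using range by (subst Bochner_Integration.integral_diff)
      (auto intro!: integrable_const_bound[of _ 1] simp: prob_space)
  finally show ?thesis by simp
qed

text \<open>\<open>F (X z)\<close> is uniform on the unit interval because \<open>F\<close> is the
  continuous cdf of \<open>X\<close>; the tail formula then gives its mean. The condition
  \<open>F 0 = 0\<close> says that \<open>X\<close> has no atom at \<open>0\<close>.\<close>

lemma (in prob_space) expectation_probability_integral_transform:
  fixes X :: "'a \<Rightarrow> real" and F :: "real \<Rightarrow> real"
  assumes X [measurable]: "X \<in> borel_measurable M"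
    and range: "\<And>z. z \<in> space M \<Longrightarrow> X z \<in> {0..1}"
    and F: "\<And>t. t \<in> {0..1} \<Longrightarrow> measure M {z \<in> space M. X z \<le> t} = F t"
    and cont: "continuous_on {0..1} F" and F0: "F 0 = 0"
  shows "expectation (\<lambda>z. F (X z)) = 1/2"
proof -
  have mono: "F s \<le> F t" if "s \<in> {0..1}" "t \<in> {0..1}" "s \<le> t" for s t
  proof -
    have "measure M {z \<in> space M. X z \<le> s} \<le> measure M {z \<in> space M. X z \<le> t}"
      using that by (intro finite_measure_mono) auto
    then show ?thesis using F that by simp
  qed
  have "{z \<in> space M. X z \<le> 1} = space M" using range by auto
  then have F1: "F 1 = 1" using F[of 1] by (simp add: prob_space)
  \<comment> \<open>\<open>F\<close> is controlled on \<open>{0..1}\<close> only. With its argument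
    clipped it is Borel on the whole line, and along \<open>X\<close> nothing changes.\<close>
  have "continuous_on UNIV (\<lambda>x. F (max 0 (min 1 x)))"
    by (rule continuous_on_compose2[OF cont]) (auto intro!: continuous_intros)
  then have "(\<lambda>x. F (max 0 (min 1 x))) \<in> borel_measurable borel"
    by (rule borel_measurable_continuous_onI)
  then have "(\<lambda>z. F (max 0 (min 1 (X z)))) \<in> borel_measurable M"
    by (rule measurable_compose[OF X])
  moreover have "F (max 0 (min 1 (X z))) = F (X z)" if "z \<in> space M" for z
    using range[OF that] by simp
  ultimately have FX: "(\<lambda>z. F (X z)) \<in> borel_measurable M"
    by (simp cong: measurable_cong)
  have FX_range: "F (X z) \<in> {0..1}" if "z \<in> space M" for z
    using range[OF that] mono[of 0 "X z"] mono[of "X z" 1] F0 F1 by auto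
  have cdf: "measure M {z \<in> space M. F (X z) \<le> s} = s" if s: "s \<in> {0..1}" for s
  proof -
    \<comment> \<open>\<open>F\<close> may be constant on intervals, so the largest point
      \<open>t\<close> of the sublevel set is taken: then \<open>F (X z) \<le> s\<close> holds
      exactly when \<open>X z \<le> t\<close>.\<close>
    define K where "K = {t \<in> {0..1}. F t \<le> s}"
    have K: "compact K" "K \<noteq> {}"
    proof -
      have "closed K"
        unfolding K_def using cont by (intro continuous_on_closed_Collect_le) auto
      then show "compact K"
        by (intro compact_eq_bounded_closed[THEN iffD2] conjI bounded_subset[OF bounded_closed_interval])
          (auto simp: K_def)
      have "0 \<in> K" using F0 s by (auto simp: K_def)
      then show "K \<noteq> {}" by blast
    qed
    obtain t where t: "t \<in> K" "\<And>t'. t' \<in> K \<Longrightarrow> t' \<le> t"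
      using compact_attains_sup[OF K] by blast
    \<comment> \<open>The level \<open>s\<close> is attained at a point of \<open>K\<close>, which
      forces \<open>F t = s\<close> at the maximum \<open>t\<close>.\<close>
    obtain t' where t': "0 \<le> t'" "t' \<le> 1" "F t' = s"
      using IVT'[of F 0 s 1] s cont F0 F1 by auto
    have "s \<le> F t" using t' t mono[of t' t] by (auto simp: K_def)
    then have Ft: "F t = s" using t by (auto simp: K_def)
    have "{z \<in> space M. F (X z) \<le> s} = {z \<in> space M. X z \<le> t}"
      using t range mono Ft by (auto simp: K_def)
    then show ?thesis using F[of t] Ft t by (auto simp: K_def)
  qed
  have "(LINT s:{0..1}|lborel. measure M {z \<in> space M. F (X z) \<le> s}) = (LINT s:{0..1}|lborel. s)"
    by (rule set_lebesgue_integral_cong) (auto simp: cdf)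
  then show ?thesis
    using expectation_eq_one_minus_cdf_integral[OF FX FX_range] by (simp add: LINT_identity_unit)
qed

subsection \<open>Existence and uniqueness of the copula measure\<close>

locale copula_function =
  fixes C :: "real \<Rightarrow> real \<Rightarrow> real"
  assumes copula: "copula C"
begin

section \<open>Monotonicity and continuity of copulas\<close>

lemma range: "u \<in> {0..1} \<Longrightarrow> v \<in> {0..1} \<Longrightarrow> C u v \<in> {0..1}"
  and zero_left: "v \<in> {0..1} \<Longrightarrow> C 0 v = 0"
  and zero_right: "u \<in> {0..1} \<Longrightarrow> C u 0 = 0"
  and one_right: "u \<in> {0..1} \<Longrightarrow> C u 1 = u"
  and one_left: "v \<in> {0..1} \<Longrightarrow> C 1 v = v"
  and two_increasing: "u1 \<in> {0..1} \<Longrightarrow> u2 \<in> {0..1} \<Longrightarrow> v1 \<in> {0..1} \<Longrightarrow> v2 \<in> {0..1} \<Longrightarrow>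
    u1 \<le> u2 \<Longrightarrow> v1 \<le> v2 \<Longrightarrow> 0 \<le> C u2 v2 - C u2 v1 - C u1 v2 + C u1 v1"
  using copula unfolding copula_def by blast+

text \<open>Monotonicity is nonnegativity of the volume of \<open>[u, u'] \<times> [0, v]\<close>,
  the growth bound that of \<open>[u, u'] \<times> [v, 1]\<close>.\<close>

lemma mono_left:
  assumes "u \<in> {0..1}" "u' \<in> {0..1}" "v \<in> {0..1}" "u \<le> u'"
  shows "C u v \<le> C u' v" "C u' v - C u v \<le> u' - u"
  using two_increasing[of u u' 0 v] two_increasing[of u u' v 1] assms
    zero_right[of u] zero_right[of u'] one_right[of u] one_right[of u'] by auto

lemma mono_right:
  assumes "u \<in> {0..1}" "v \<in> {0..1}" "v' \<in> {0..1}" "v \<le> v'"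
  shows "C u v \<le> C u v'" "C u v' - C u v \<le> v' - v"
  using two_increasing[of 0 u v v'] two_increasing[of u 1 v v'] assms
    zero_left[of v] zero_left[of v'] one_left[of v] one_left[of v'] by auto

lemma lipschitz:
  assumes "u \<in> {0..1}" "u' \<in> {0..1}" "v \<in> {0..1}" "v' \<in> {0..1}"
  shows "\<bar>C u v - C u' v'\<bar> \<le> \<bar>u - u'\<bar> + \<bar>v - v'\<bar>"
proof -
  have "\<bar>C u v - C u' v\<bar> \<le> \<bar>u - u'\<bar>"
    using mono_left[of u u' v] mono_left[of u' u v] assms by linarith
  moreover have "\<bar>C u' v - C u' v'\<bar> \<le> \<bar>v - v'\<bar>"
    using mono_right[of u' v v'] mono_right[of u' v' v] assms by linarith
  ultimately show ?thesis by linarith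
qed

lemma continuous_on_copula: "continuous_on ({0..1} \<times> {0..1}) (\<lambda>(u, v). C u v)"
proof (rule continuous_onI)
  fix p :: "real \<times> real" and e :: real
  assume p: "p \<in> {0..1} \<times> {0..1}" and e: "0 < e"
  have "dist (case p' of (u, v) \<Rightarrow> C u v) (case p of (u, v) \<Rightarrow> C u v) \<le> e"
    if p': "p' \<in> {0..1} \<times> {0..1}" and d: "dist p' p < e / 2" for p'
  proof -
    have "\<bar>fst p' - fst p\<bar> < e / 2" "\<bar>snd p' - snd p\<bar> < e / 2"
      using le_less_trans[OF dist_fst_le d] le_less_trans[OF dist_snd_le d]
      by (auto simp: dist_real_def)
    then show ?thesis
      using lipschitz[of "fst p'" "fst p" "snd p'" "snd p"] p p'
      by (auto simp: dist_real_def split_beta)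
  qed
  then show "\<exists>d>0. \<forall>p'\<in>{0..1} \<times> {0..1}. dist p' p < d \<longrightarrow>
      dist (case p' of (u, v) \<Rightarrow> C u v) (case p of (u, v) \<Rightarrow> C u v) \<le> e"
    using e by (intro exI[of _ "e / 2"]) auto
qed

lemma continuous_on_copula_compose:
  assumes "continuous_on S f" "continuous_on S g" "f ` S \<subseteq> {0..1}" "g ` S \<subseteq> {0..1}"
  shows "continuous_on S (\<lambda>x. C (f x) (g x))"
  using continuous_on_compose2[OF continuous_on_copula, of S "\<lambda>x. (f x, g x)"] assms
  by (auto intro: continuous_on_Pair)

text \<open>In terms of the variables to be constructed this is
  \<open>x \<mapsto> P(U \<le> x, V \<le> v)\<close>. For \<open>v = 1\<close> it is the cdf of the
  uniform distribution.\<close>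

definition section_cdf :: "real \<Rightarrow> real \<Rightarrow> real" where
  "section_cdf v x = C (unit_clip x) v"

text \<open>Monotonicity of the difference is the rectangle inequality. Hence the Stieltjes measures
  of the sections increase with \<open>v\<close>, and the uniform measure dominates them
  all.\<close>

lemma continuous_cdf_section_diff:
  assumes "v \<in> {0..1}" "v' \<in> {0..1}" "v \<le> v'"
  shows "continuous_cdf_on_unit (\<lambda>x. section_cdf v' x - section_cdf v x)"
  unfolding continuous_cdf_on_unit_def
proof (intro conjI allI impI)
  show "mono (\<lambda>x. section_cdf v' x - section_cdf v x)"
  proof (rule monoI)
    fix x y :: real assume "x \<le> y"
    then show "section_cdf v' x - section_cdf v x \<le> section_cdf v' y - section_cdf v y"
      using two_increasing[of "unit_clip x" "unit_clip y" v v'] assms unit_clip_mono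
      by (simp add: section_cdf_def)
  qed
  show "continuous_on UNIV (\<lambda>x. section_cdf v' x - section_cdf v x)"
    unfolding section_cdf_def using assms
    by (intro continuous_on_diff continuous_on_copula_compose continuous_intros) auto
qed (use assms zero_left in \<open>auto simp: section_cdf_def unit_clip_def\<close>)

lemma continuous_cdf_section:
  assumes "v \<in> {0..1}"
  shows "continuous_cdf_on_unit (section_cdf v)"
proof -
  have "(\<lambda>x. section_cdf v x - section_cdf 0 x) = section_cdf v"
    by (auto simp: section_cdf_def zero_right)
  then show ?thesis using continuous_cdf_section_diff[of 0 v] assms by simp
qed

lemma prob_space_section_one: "prob_space (interval_measure (section_cdf 1))"
  using emeasure_interval_measure_UNIV_unit[OF continuous_cdf_section[of 1]]
  by (intro prob_spaceI) (simp add: section_cdf_def unit_clip_id one_left)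

text \<open>The density at \<open>x\<close> is a version of the conditional probability of
  \<open>V \<le> q\<close> given \<open>U = x\<close>. It exists because the uniform measure
  dominates that of the section at \<open>q\<close>.\<close>

lemma section_density_exists:
  assumes q: "q \<in> {0..1}"
  shows "\<exists>h\<in>borel_measurable borel.
    density (interval_measure (section_cdf 1)) h = interval_measure (section_cdf q)"
proof -
  interpret prob_space "interval_measure (section_cdf 1)"
    by (rule prob_space_section_one)
  have "emeasure (interval_measure (section_cdf q)) A \<le> emeasure (interval_measure (section_cdf 1)) A"
    if "A \<in> sets borel" for A
    using emeasure_interval_measure_add[OF continuous_cdf_section[OF q]
        continuous_cdf_section_diff[OF q, of 1] that] q
    by (simp add: add_increasing2)
  then have "absolutely_continuous (interval_measure (section_cdf 1)) (interval_measure (section_cdf q))"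
    unfolding absolutely_continuous_def null_sets_def by auto (metis le_zero_eq)
  then show ?thesis
    using Radon_Nikodym[of "interval_measure (section_cdf q)"]
    by (auto simp: measurable_cong_sets[OF sets_interval_measure refl])
qed

section \<open>Construction of the measure from conditional quantiles\<close>

definition represents_copula :: "(real \<times> real) measure \<Rightarrow> bool" where
  "represents_copula M \<longleftrightarrow>
     sets M = sets (restrict_space borel ({0..1} \<times> {0..1})) \<and> prob_space M \<and>
     (\<forall>u\<in>{0..1}. \<forall>v\<in>{0..1}. measure M ({0..u} \<times> {0..v}) = C u v)"

text \<open>\<open>g q x\<close> is the conditional cdf of \<open>V\<close> given
  \<open>U = x\<close>, of interest at rational levels \<open>q\<close>. Monotonicity in
  \<open>q\<close> at every single \<open>x\<close> is what the quantile construction uses; the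
  bound by \<open>1\<close> may fail on a null set.\<close>

lemma monotone_conditional_cdf_exists:
  obtains g :: "real \<Rightarrow> real \<Rightarrow> ennreal" where
    "\<And>q. g q \<in> borel_measurable borel"
    "\<And>q q' x. q \<le> q' \<Longrightarrow> g q x \<le> g q' x"
    "\<And>q. q \<in> \<rat> \<inter> {0..1} \<Longrightarrow> AE x in interval_measure (section_cdf 1). g q x \<le> 1"
    "\<And>q. q \<in> \<rat> \<inter> {0..1} \<Longrightarrow>
      density (interval_measure (section_cdf 1)) (g q) = interval_measure (section_cdf q)"
proof -
  let ?\<nu> = "interval_measure (section_cdf 1)"
  have "\<exists>h. \<forall>q\<in>{0..1}. h q \<in> borel_measurable borel \<and>
      density ?\<nu> (h q) = interval_measure (section_cdf q)"
    using section_density_exists by (intro bchoice) blast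
  then obtain h where h: "\<And>q. q \<in> {0..1} \<Longrightarrow> h q \<in> borel_measurable borel"
      "\<And>q. q \<in> {0..1} \<Longrightarrow> density ?\<nu> (h q) = interval_measure (section_cdf q)"
    by blast
  define g where "g q x = (SUP p\<in>{p \<in> \<rat> \<inter> {0..1}. p \<le> q}. h p x)" for q x
  have count: "countable {p \<in> \<rat> \<inter> {0..1}. p \<le> (q::real)}" for q
    by (rule countable_subset[OF _ countable_rat]) auto
  \<comment> \<open>The \<open>h q\<close> increase in \<open>q\<close> only almost everywhere; the supremum makes this hold everywhere.\<close>
  have g_meas: "g q \<in> borel_measurable borel" for q
    unfolding g_def[abs_def] by (intro borel_measurable_SUP count h) auto
  have h_mono: "AE x in ?\<nu>. h p x \<le> h q x" if "p \<in> {0..1}" "q \<in> {0..1}" "p \<le> q" for p q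
    by (rule interval_measure_density_mono[of "section_cdf p" "section_cdf q" "section_cdf 1"])
      (use that in \<open>auto intro!: continuous_cdf_section continuous_cdf_section_diff h\<close>)
  have one: "AE x in ?\<nu>. h q x \<le> 1" if "q \<in> {0..1}" for q
    by (rule interval_measure_density_mono[of "section_cdf q" "section_cdf 1" "section_cdf 1"])
      (use that in \<open>auto intro!: continuous_cdf_section continuous_cdf_section_diff h density_1
        simp: continuous_cdf_on_unit_zero\<close>)
  have g_eq: "AE x in ?\<nu>. g q x = h q x" if q: "q \<in> \<rat> \<inter> {0..1}" for q
  proof -
    \<comment> \<open>Countability of the rational levels lets one null set serve for all
      \<open>p \<le> q\<close>.\<close>
    have "AE x in ?\<nu>. \<forall>p\<in>{p \<in> \<rat> \<inter> {0..1}. p \<le> q}. h p x \<le> h q x"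
      using q by (subst AE_ball_countable[OF count]) (auto intro: h_mono)
    then show ?thesis
    proof eventually_elim
      case (elim x)
      then show ?case
        unfolding g_def using q by (intro antisym SUP_least SUP_upper) auto
    qed
  qed
  show thesis
  proof
    show "g q \<in> borel_measurable borel" for q by (rule g_meas)
    show "g q x \<le> g q' x" if "q \<le> q'" for q q' x
      unfolding g_def using that by (intro SUP_subset_mono) auto
    show "AE x in ?\<nu>. g q x \<le> 1" if "q \<in> \<rat> \<inter> {0..1}" for q
      using g_eq[OF that] one[of q] that by auto
    show "density ?\<nu> (g q) = interval_measure (section_cdf q)" if "q \<in> \<rat> \<inter> {0..1}" for q
      using h(2)[of q] that g_eq[OF that] h(1)[of q] g_meas[of q]
      by (subst density_cong[of _ _ "h q"])
        (auto simp: measurable_cong_sets[OF sets_interval_measure refl])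
  qed
qed

text \<open>\<open>P(U \<le> u, W \<le> g q U)\<close> is the integral of \<open>g q\<close> over
  \<open>U \<le> u\<close>, which is \<open>C u q\<close>. The event \<open>V \<le> v\<close> is
  squeezed between such events at rational levels near \<open>v\<close>, and the Lipschitz bound in
  the second argument closes the gap.\<close>

lemma copula_measure_exists: "\<exists>M. represents_copula M"
proof -
  let ?\<nu> = "interval_measure (section_cdf 1)"
  let ?Q = "\<rat> \<inter> {0..1::real}"
  obtain g :: "real \<Rightarrow> real \<Rightarrow> ennreal" where
    g_meas[measurable]: "\<And>q. g q \<in> borel_measurable borel"
    and g_mono: "\<And>q q' x. q \<le> q' \<Longrightarrow> g q x \<le> g q' x"
    and g_le_1: "\<And>q. q \<in> ?Q \<Longrightarrow> AE x in ?\<nu>. g q x \<le> 1"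
    and g_density: "\<And>q. q \<in> ?Q \<Longrightarrow> density ?\<nu> (g q) = interval_measure (section_cdf q)"
    using monotone_conditional_cdf_exists by blast
  interpret \<nu>: prob_space ?\<nu> by (rule prob_space_section_one)
  interpret P: pair_prob_space ?\<nu> ?\<nu> ..
  let ?P = "?\<nu> \<Otimes>\<^sub>M ?\<nu>"
  have sets_P: "sets ?P = sets (borel \<Otimes>\<^sub>M borel)"
    by (intro sets_pair_measure_cong) simp_all
  have space_P: "space ?P = UNIV"
    by (simp add: space_pair_measure)
  \<comment> \<open>\<open>fst z\<close> gives \<open>U\<close> after clipping and
    \<open>snd z\<close> is \<open>W\<close>; on \<open>S q\<close> the conditional cdf at level
    \<open>q\<close> has reached \<open>W\<close>. The \<open>1\<close> inserted in the definition
    of \<open>V\<close> covers the points that lie in no \<open>S q\<close>.\<close>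
  define S where "S q = {z. ennreal (snd z) \<le> g q (fst z)}" for q
  define V where "V z = Inf (insert 1 {q \<in> ?Q. z \<in> S q})" for z
  define L where "L u = {z :: real \<times> real. unit_clip (fst z) \<le> u}" for u
  have S_meas [measurable]: "S q \<in> sets (borel \<Otimes>\<^sub>M borel)" for q
    using borel_measurable_le[of "\<lambda>z. ennreal (snd z)" "borel \<Otimes>\<^sub>M borel" "\<lambda>z. g q (fst z)"]
    by (simp add: S_def space_pair_measure)
  have L_meas [measurable]: "L u \<in> sets (borel \<Otimes>\<^sub>M borel)" for u
    using borel_measurable_le[of "\<lambda>z. unit_clip (fst z)" "borel \<Otimes>\<^sub>M borel" "\<lambda>_. u"]
    by (simp add: L_def space_pair_measure)
  have bdd: "bdd_below (insert 1 {q \<in> ?Q. z \<in> S q})" for z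
    by (rule bdd_belowI[of _ 0]) auto
  have V_range: "V z \<in> {0..1}" for z
  proof -
    have "V z \<le> 1" unfolding V_def by (rule cInf_lower[OF _ bdd]) simp
    moreover have "0 \<le> V z" unfolding V_def by (rule cInf_greatest) auto
    ultimately show ?thesis by simp
  qed
  \<comment> \<open>The restriction \<open>y \<le> 1\<close> keeps the inserted value
    \<open>1\<close> from witnessing the strict inequality.\<close>
  have V_less: "V z < y \<longleftrightarrow> (\<exists>q\<in>?Q. q < y \<and> z \<in> S q)" if "y \<le> 1" for z y
    unfolding V_def using that by (subst cInf_less_iff[OF _ bdd]) auto
  have V_le: "V z \<le> q" if "q \<in> ?Q" "z \<in> S q" for z q
    unfolding V_def using that by (intro cInf_lower bdd) auto
  have V_meas [measurable]: "V \<in> borel_measurable (borel \<Otimes>\<^sub>M borel)"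
  proof (rule borel_measurableI_less)
    fix y
    show "{z \<in> space (borel \<Otimes>\<^sub>M borel). V z < y} \<in> sets (borel \<Otimes>\<^sub>M borel)"
    proof (cases "y \<le> 1")
      case True
      have "countable {q \<in> ?Q. q < y}"
        by (rule countable_subset[OF _ countable_rat]) auto
      moreover have "{z \<in> space (borel \<Otimes>\<^sub>M borel). V z < y} = (\<Union>q\<in>{q \<in> ?Q. q < y}. S q)"
        using V_less[OF True] by (auto simp: space_pair_measure)
      ultimately show ?thesis by (auto intro!: sets.countable_UN' S_meas)
    next
      case False
      then have "V z < y" for z
        using V_range[of z] by simp
      then show ?thesis by simp
    qed
  qed
  \<comment> \<open>\<open>W\<close> is uniform. Negative \<open>w\<close> have
    \<open>ennreal w = 0\<close>, so the set is a full half-line ending at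
    \<open>enn2real c\<close>.\<close>
  have \<nu>_le: "emeasure ?\<nu> {w. ennreal w \<le> c} = c" if "c \<le> 1" for c
  proof -
    have "c \<noteq> \<top>" using that by (auto simp: top_unique)
    then have c: "c = ennreal (enn2real c)"
      using ennreal_enn2real[of c] by (simp add: less_top)
    then have c1: "enn2real c \<in> {0..1}"
      using that by (metis atLeastAtMost_iff enn2real_nonneg enn2real_leI ennreal_1 zero_le_one)
    have "{w. ennreal w \<le> c} = {..enn2real c}"
      using ennreal_le_iff[of "enn2real c"] c by (metis (no_types, lifting) Collect_cong atMost_def enn2real_nonneg)
    then show ?thesis
      using emeasure_interval_measure_atMost_unit[OF continuous_cdf_section[of 1], of "enn2real c"] c c1
      by (simp add: section_cdf_def unit_clip_id one_right)
  qed
  have P_LS: "emeasure ?P (L u \<inter> S q) = C u q" if u: "u \<in> {0..1}" and q: "q \<in> ?Q" for u q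
  proof -
    have "emeasure ?P (L u \<inter> S q) = (\<integral>\<^sup>+x. emeasure ?\<nu> (Pair x -` (L u \<inter> S q)) \<partial>?\<nu>)"
      by (rule \<nu>.emeasure_pair_measure_alt) (simp add: sets_P)
    \<comment> \<open>For fixed \<open>x\<close> the slice consists of all \<open>w\<close> up to
      \<open>g q x\<close>, so uniformity of \<open>W\<close> gives it the mass \<open>g q x\<close>
      wherever this is at most \<open>1\<close>.\<close>
    also have "\<dots> = (\<integral>\<^sup>+x. g q x * indicator {x. unit_clip x \<le> u} x \<partial>?\<nu>)"
    proof (rule nn_integral_cong_AE)
      show "AE x in ?\<nu>. emeasure ?\<nu> (Pair x -` (L u \<inter> S q)) = g q x * indicator {x. unit_clip x \<le> u} x"
        using g_le_1[OF q]
      proof eventually_elim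
        case (elim x)
        have "Pair x -` (L u \<inter> S q) = (if unit_clip x \<le> u then {w. ennreal w \<le> g q x} else {})"
          by (auto simp: L_def S_def)
        then show ?case using \<nu>_le[OF elim] by simp
      qed
    qed
    also have "\<dots> = emeasure (density ?\<nu> (g q)) {x. unit_clip x \<le> u}"
      by (subst emeasure_density) auto
    also have "\<dots> = C u q"
      using interval_measure_unit_clip_le[OF continuous_cdf_section u] u q
      by (simp add: g_density[OF q] section_cdf_def unit_clip_id)
    finally show ?thesis .
  qed
  have P_L: "emeasure ?P (L u) = u" if u: "u \<in> {0..1}" for u
  proof -
    have "L u = {x. unit_clip x \<le> u} \<times> UNIV" by (auto simp: L_def)
    then show ?thesis
      using interval_measure_unit_clip_le[OF continuous_cdf_section[of 1] u] u \<nu>.emeasure_space_1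
      by (simp add: \<nu>.emeasure_pair_measure_Times section_cdf_def unit_clip_id one_right)
  qed
  define R where "R u v = L u \<inter> {z. V z \<le> v}" for u v
  have R_meas [measurable]: "R u v \<in> sets (borel \<Otimes>\<^sub>M borel)" for u v
    using sets.Int[OF L_meas borel_measurable_le[OF V_meas borel_measurable_const[of v]]]
    by (simp add: R_def space_pair_measure)
  have P_R: "measure ?P (R u v) = C u v" if u: "u \<in> {0..1}" and v: "v \<in> {0..1}" for u v
  proof (rule antisym)
    have measure_LS: "measure ?P (L u \<inter> S q) = C u q" if "q \<in> ?Q" for q
      using P_LS[OF u that] range[OF u, of q] that by (simp add: measure_def)
    show "measure ?P (R u v) \<le> C u v"
    \<comment> \<open>The approximation from above needs a rational level strictly between
      \<open>v\<close> and \<open>1\<close>. For \<open>v = 1\<close> the first marginal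
      suffices.\<close>
    proof (cases "v = 1")
      case True
      have "measure ?P (R u v) \<le> measure ?P (L u)"
        by (rule P.finite_measure_mono) (auto simp: R_def sets_P)
      also have "\<dots> = C u v"
        using P_L[OF u] u True by (simp add: measure_def one_right)
      finally show ?thesis .
    next
      case False
      show ?thesis
      proof (rule field_le_epsilon)
        fix e :: real assume "0 < e"
        with False v have "v < min 1 (v + e)" by auto
        then obtain q where q: "q \<in> \<rat>" "v < q" "q < min 1 (v + e)"
          using Rats_dense_in_real by blast
        \<comment> \<open>\<open>V z < q\<close> is strict, so some rational \<open>p < q\<close>
          has \<open>z \<in> S p\<close>, and the everywhere valid monotonicity of \<open>g\<close>
          moves \<open>z\<close> into \<open>S q\<close>.\<close>
        have "R u v \<subseteq> L u \<inter> S q"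
        proof
          fix z assume z: "z \<in> R u v"
          then have "V z < q" using q by (auto simp: R_def)
          then obtain p where "p < q" "z \<in> S p" using V_less[of q z] q by auto
          then show "z \<in> L u \<inter> S q"
            using z g_mono[of p q "fst z"] by (auto simp: R_def S_def)
        qed
        then have "measure ?P (R u v) \<le> measure ?P (L u \<inter> S q)"
          by (rule P.finite_measure_mono) (simp add: sets_P)
        also have "\<dots> = C u q" using q v by (intro measure_LS) auto
        also have "\<dots> \<le> C u v + e" using mono_right[of u v q] u v q by auto
        finally show "measure ?P (R u v) \<le> C u v + e" .
      qed
    qed
    show "C u v \<le> measure ?P (R u v)"
    proof (rule field_le_epsilon)
      fix e :: real assume e: "0 < e"
      obtain q where q: "q \<in> ?Q" "q \<le> v" "v \<le> q + e"
      proof (cases "v = 0")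
        case True
        then show ?thesis using that[of 0] e by auto
      next
        case False
        with e v have "max 0 (v - e) < v" by auto
        then obtain q where "q \<in> \<rat>" "max 0 (v - e) < q" "q < v"
          using Rats_dense_in_real by blast
        then show ?thesis using that[of q] v by auto
      qed
      have "C u v \<le> C u q + e" using mono_right[of u q v] u v q by auto
      also have "C u q = measure ?P (L u \<inter> S q)" using q by (simp add: measure_LS)
      also have "\<dots> \<le> measure ?P (R u v)"
      proof (rule P.finite_measure_mono)
        show "L u \<inter> S q \<subseteq> R u v" using V_le[OF q(1)] q(2) by (force simp: R_def)
        show "R u v \<in> sets ?P" by (simp add: sets_P)
      qed
      finally show "C u v \<le> measure ?P (R u v) + e" by simp
    qed
  qed
  \<comment> \<open>The pair \<open>(U, V)\<close>. Clipping puts it in the unit square everywhere,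
    not just almost everywhere.\<close>
  let ?T = "\<lambda>z. (unit_clip (fst z), V z)"
  let ?B = "restrict_space borel ({0..1} \<times> {0..1 :: real}) :: (real \<times> real) measure"
  have T_meas: "?T \<in> measurable ?P ?B"
  proof (rule measurable_restrict_space2)
    have "?T \<in> measurable (borel \<Otimes>\<^sub>M borel) (borel \<Otimes>\<^sub>M borel)" by measurable
    then show "?T \<in> measurable ?P borel"
      by (simp add: measurable_cong_sets[OF sets_P refl] borel_prod)
  qed (use V_range in auto)
  have "represents_copula (distr ?P ?B ?T)"
    unfolding represents_copula_def
  proof (intro conjI ballI)
    show "prob_space (distr ?P ?B ?T)" by (rule P.prob_space_distr[OF T_meas])
    fix u v :: real assume uv: "u \<in> {0..1}" "v \<in> {0..1}"
    have "{0..u} \<times> {0..v} \<in> sets borel"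
      by (intro borel_closed closed_Times closed_atLeastAtMost)
    then have "{0..u} \<times> {0..v} \<in> sets ?B"
      using uv by (subst sets_restrict_space_iff) (auto intro: borel_closed closed_Times)
    then have "measure (distr ?P ?B ?T) ({0..u} \<times> {0..v}) =
        measure ?P (?T -` ({0..u} \<times> {0..v}) \<inter> space ?P)"
      by (rule measure_distr[OF T_meas])
    also have "?T -` ({0..u} \<times> {0..v}) \<inter> space ?P = R u v"
      using V_range by (auto simp: space_P R_def L_def)
    finally show "measure (distr ?P ?B ?T) ({0..u} \<times> {0..v}) = C u v"
      using P_R uv by simp
  qed simp
  then show ?thesis by blast
qed

text \<open>Both measures are carried over to the plane, where the quadrants \<open>{..p}\<close>
  form an intersection-stable generator of the Borel sets. A quadrant meets the unit square in the
  empty set or in an anchored rectangle, whose mass is a value of \<open>C\<close>.\<close>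

lemma copula_measure_unique:
  assumes M: "represents_copula M" and N: "represents_copula N"
  shows "M = N"
proof -
  let ?I = "{0..1} \<times> {0..1} :: (real \<times> real) set"
  have closed: "?I \<in> sets borel"
    by (intro borel_closed closed_Times closed_atLeastAtMost)
  \<comment> \<open>\<open>distr K borel id\<close> extends \<open>K\<close> to the plane by zero
    outside the square.\<close>
  have ext: "sets K = sets (restrict_space borel ?I) \<Longrightarrow> A \<in> sets borel \<Longrightarrow>
      emeasure (distr K borel id) A = emeasure K (A \<inter> ?I)" for K A
    by (subst emeasure_distr)
      (auto simp: measurable_cong_sets[of K "restrict_space borel ?I"] space_restrict_space
        dest: sets_eq_imp_space_eq intro: measurable_restrict_space1)
  have corner: "emeasure K ({..p} \<inter> ?I) =
      (if 0 \<le> fst p \<and> 0 \<le> snd p then ennreal (C (unit_clip (fst p)) (unit_clip (snd p))) else 0)"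
    if K: "represents_copula K" for K p
  proof -
    interpret prob_space K using K by (simp add: represents_copula_def)
    have *: "{..p} \<inter> ?I = (if 0 \<le> fst p \<and> 0 \<le> snd p
        then {0..unit_clip (fst p)} \<times> {0..unit_clip (snd p)} else {})"
      by (cases p) (auto simp: unit_clip_def less_eq_prod_def)
    show ?thesis
      unfolding * using K by (simp add: emeasure_eq_measure represents_copula_def)
  qed
  have "distr M borel id = distr N borel id"
  proof (rule measure_eqI_generator_eq)
    let ?E = "range atMost :: (real \<times> real) set set"
    show "Int_stable ?E"
    proof (rule Int_stableI_image)
      fix p q :: "real \<times> real"
      show "\<exists>r\<in>UNIV. {..p} \<inter> {..q} = {..r}"
        by (intro bexI[of _ "inf p q"]) auto
    qed
    show "emeasure (distr M borel id) X = emeasure (distr N borel id) X" if X: "X \<in> ?E" for X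
    proof -
      have "X \<in> sets borel" using X by auto
      then show ?thesis
        using X M N corner[OF M] corner[OF N] by (auto simp: ext represents_copula_def)
    qed
    show "sets (distr M borel id) = sigma_sets UNIV ?E" "sets (distr N borel id) = sigma_sets UNIV ?E"
      by (simp_all add: borel_eq_atMost)
    let ?A = "\<lambda>i::nat. {..(real i, real i)}"
    show "range ?A \<subseteq> ?E" by auto
    show "(\<Union>i. ?A i) = UNIV"
    proof safe
      fix a b :: real
      obtain i :: nat where "max a b \<le> real i" using real_arch_simple by blast
      then show "(a, b) \<in> (\<Union>i. ?A i)" by (auto simp: less_eq_prod_def)
    qed auto
    interpret M: prob_space M using M by (simp add: represents_copula_def)
    show "emeasure (distr M borel id) (?A i) \<noteq> \<infinity>" for i
      using M by (simp add: ext represents_copula_def)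
  qed auto
  moreover have "sets M = sets (restrict_space borel ?I)" "sets N = sets (restrict_space borel ?I)"
    using M N by (auto simp: represents_copula_def)
  ultimately show ?thesis
  proof (intro measure_eqI)
    assume eq: "distr M borel id = distr N borel id"
      and sM: "sets M = sets (restrict_space borel ?I)" and sN: "sets N = sets (restrict_space borel ?I)"
    fix A assume "A \<in> sets M"
    then have A: "A \<in> sets borel" "A \<inter> ?I = A"
      using closed by (auto simp: sM sets_restrict_space_iff)
    show "emeasure M A = emeasure N A"
      using ext[OF sM A(1)] ext[OF sN A(1)] eq A(2) by simp
  qed auto
qed

lemma represents_copula_measure: "represents_copula (copula_measure C)"
proof -
  have "copula_measure C = (THE M. represents_copula M)"
    by (simp add: copula_measure_def represents_copula_def)
  moreover have "represents_copula (THE M. represents_copula M)"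
    using copula_measure_exists copula_measure_unique by (metis theI)
  ultimately show ?thesis by simp
qed

subsection \<open>Bounds on the Kendall integral\<close>

sublocale prob_space "copula_measure C"
  using represents_copula_measure by (simp add: represents_copula_def)

section \<open>Measurability and integrability on the square\<close>

lemma sets_copula_measure: "sets (copula_measure C) = sets (restrict_space borel ({0..1} \<times> {0..1}))"
  and measure_copula_measure: "u \<in> {0..1} \<Longrightarrow> v \<in> {0..1} \<Longrightarrow>
    measure (copula_measure C) ({0..u} \<times> {0..v}) = C u v"
  using represents_copula_measure by (auto simp: represents_copula_def)

lemma space_copula_measure: "space (copula_measure C) = {0..1} \<times> {0..1}"
  using sets_eq_imp_space_eq[OF sets_copula_measure] by (simp add: space_restrict_space)

lemma borel_measurable_copula_measure:
  fixes f :: "real \<times> real \<Rightarrow> real"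
  assumes "continuous_on ({0..1} \<times> {0..1}) f"
  shows "f \<in> borel_measurable (copula_measure C)"
  using borel_measurable_continuous_on_restrict[OF assms]
  by (simp add: measurable_cong_sets[OF sets_copula_measure refl])

lemma measurable_fst_snd_copula_measure [measurable]:
  "fst \<in> borel_measurable (copula_measure C)" "snd \<in> borel_measurable (copula_measure C)"
  by (intro borel_measurable_copula_measure continuous_intros)+

lemma integrable_copula_measure:
  fixes f :: "real \<times> real \<Rightarrow> real"
  assumes "continuous_on ({0..1} \<times> {0..1}) f"
  shows "integrable (copula_measure C) f"
proof -
  have "compact (f ` ({0..1} \<times> {0..1}))"
    by (intro compact_continuous_image assms compact_Times compact_Icc)
  then obtain B where "\<forall>x\<in>f ` ({0..1} \<times> {0..1}). norm x \<le> B"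
    using compact_imp_bounded bounded_iff by blast
  then show ?thesis
    by (intro integrable_const_bound[of _ B] borel_measurable_copula_measure assms AE_I2)
      (auto simp: space_copula_measure)
qed

section \<open>Distribution functions of the coordinates and of the two minima\<close>

lemma prob_le_le:
  assumes "u \<in> {0..1}" "v \<in> {0..1}"
  shows "prob {z \<in> space (copula_measure C). fst z \<le> u \<and> snd z \<le> v} = C u v"
proof -
  have "{z \<in> space (copula_measure C). fst z \<le> u \<and> snd z \<le> v} = {0..u} \<times> {0..v}"
    using assms by (auto simp: space_copula_measure)
  then show ?thesis using measure_copula_measure[OF assms] by simp
qed

lemma prob_fst_le:
  assumes "u \<in> {0..1}"
  shows "prob {z \<in> space (copula_measure C). fst z \<le> u} = u"
proof -
  have "{z \<in> space (copula_measure C). fst z \<le> u} =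
      {z \<in> space (copula_measure C). fst z \<le> u \<and> snd z \<le> 1}"
    by (auto simp: space_copula_measure)
  then show ?thesis using prob_le_le[OF assms, of 1] one_right[OF assms] by simp
qed

lemma prob_snd_le:
  assumes "v \<in> {0..1}"
  shows "prob {z \<in> space (copula_measure C). snd z \<le> v} = v"
proof -
  have "{z \<in> space (copula_measure C). snd z \<le> v} =
      {z \<in> space (copula_measure C). fst z \<le> 1 \<and> snd z \<le> v}"
    by (auto simp: space_copula_measure)
  then show ?thesis using prob_le_le[OF _ assms, of 1] one_left[OF assms] by simp
qed

text \<open>Horizontal lines carry no mass: passing from \<open>v\<close> to a level
  \<open>w < v\<close> loses at most \<open>v - w\<close> by the Lipschitz bound.\<close>

lemma prob_le_less:
  assumes u: "u \<in> {0..1}" and v: "v \<in> {0..1}"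
  shows "prob {z \<in> space (copula_measure C). fst z \<le> u \<and> snd z < v} = C u v"
proof (cases "v = 0")
  case True
  then have "{z \<in> space (copula_measure C). fst z \<le> u \<and> snd z < v} = {}"
    by (auto simp: space_copula_measure)
  then show ?thesis using True zero_right[OF u] by (metis measure_empty)
next
  case False
  show ?thesis
  proof (rule antisym)
    have "prob {z \<in> space (copula_measure C). fst z \<le> u \<and> snd z < v} \<le>
        prob {z \<in> space (copula_measure C). fst z \<le> u \<and> snd z \<le> v}"
      by (rule finite_measure_mono) auto
    then show "prob {z \<in> space (copula_measure C). fst z \<le> u \<and> snd z < v} \<le> C u v"
      using prob_le_le[OF u v] by simp
    show "C u v \<le> prob {z \<in> space (copula_measure C). fst z \<le> u \<and> snd z < v}"
    proof (rule field_le_epsilon)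
      fix e :: real assume e: "0 < e"
      \<comment> \<open>Since \<open>v \<noteq> 0\<close> here, \<open>w\<close> stays strictly
        below \<open>v\<close> even when it is cut off at \<open>0\<close>.\<close>
      define w where "w = max 0 (v - e)"
      have w: "w \<in> {0..1}" "w < v" "v - w \<le> e"
        using v e False by (auto simp: w_def)
      have "C u v \<le> C u w + e" using mono_right[OF u w(1) v] w by simp
      also have "C u w = prob {z \<in> space (copula_measure C). fst z \<le> u \<and> snd z \<le> w}"
        using prob_le_le[OF u w(1)] by simp
      also have "\<dots> \<le> prob {z \<in> space (copula_measure C). fst z \<le> u \<and> snd z < v}"
        using w by (intro finite_measure_mono) auto
      finally show "C u v \<le> prob {z \<in> space (copula_measure C). fst z \<le> u \<and> snd z < v} + e"
        by simp
    qed
  qed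
qed

lemma prob_snd_less:
  assumes v: "v \<in> {0..1}"
  shows "prob {z \<in> space (copula_measure C). snd z < v} = v"
proof -
  have "{z \<in> space (copula_measure C). snd z < v} =
      {z \<in> space (copula_measure C). fst z \<le> 1 \<and> snd z < v}"
    by (auto simp: space_copula_measure)
  then show ?thesis using prob_le_less[OF _ v, of 1] one_left[OF v] by simp
qed

text \<open>Inclusion-exclusion for the events \<open>U \<le> t\<close> and
  \<open>V \<le> t\<close>.\<close>

lemma prob_min_le:
  assumes t: "t \<in> {0..1}"
  shows "prob {z \<in> space (copula_measure C). min (fst z) (snd z) \<le> t} = 2 * t - C t t"
proof -
  let ?A = "{z \<in> space (copula_measure C). fst z \<le> t}"
  let ?B = "{z \<in> space (copula_measure C). snd z \<le> t}"
  have "{z \<in> space (copula_measure C). min (fst z) (snd z) \<le> t} = ?A \<union> ?B"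
    by (auto simp: min_le_iff_disj)
  moreover have "prob (?A \<union> ?B) = prob ?A + prob ?B - prob (?A \<inter> ?B)"
    by (rule measure_Un3) (auto simp: fmeasurable_eq_sets)
  moreover have "?A \<inter> ?B = {z \<in> space (copula_measure C). fst z \<le> t \<and> snd z \<le> t}"
    by auto
  ultimately show ?thesis
    using prob_fst_le[OF t] prob_snd_le[OF t] prob_le_le[OF t t] by simp
qed

text \<open>The complementary event is \<open>U > t\<close> together with \<open>V < 1 - t\<close>,
  of probability \<open>(1 - t) - C t (1 - t)\<close>. Reflecting \<open>V\<close> is what brings in
  the strict inequality.\<close>

lemma prob_min_flip_le:
  assumes t: "t \<in> {0..1}"
  shows "prob {z \<in> space (copula_measure C). min (fst z) (1 - snd z) \<le> t} = t + C t (1 - t)"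
proof -
  let ?A = "{z \<in> space (copula_measure C). snd z < 1 - t}"
  let ?B = "{z \<in> space (copula_measure C). fst z \<le> t \<and> snd z < 1 - t}"
  have t': "1 - t \<in> {0..1}" using t by auto
  have "{z \<in> space (copula_measure C). min (fst z) (1 - snd z) \<le> t} =
      space (copula_measure C) - (?A - ?B)"
    by (auto simp: min_le_iff_disj)
  moreover have "prob (space (copula_measure C) - (?A - ?B)) = 1 - prob (?A - ?B)"
    by (rule prob_compl) measurable
  moreover have "prob (?A - ?B) = prob ?A - prob ?B"
    by (rule finite_measure_Diff) auto
  ultimately show ?thesis
    using prob_snd_less[OF t'] prob_le_less[OF t t'] by simp
qed

section \<open>Means of the minima and of their transforms\<close>

lemma continuous_on_diagonal: "continuous_on {0..1} (\<lambda>t. C t t)"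
  and continuous_on_antidiagonal: "continuous_on {0..1} (\<lambda>t. C t (1 - t))"
  by (intro continuous_on_copula_compose continuous_intros; auto)+

lemma set_integrable_unit:
  fixes f :: "real \<Rightarrow> real"
  assumes "continuous_on {0..1} f"
  shows "set_integrable lborel {0..1} f"
  unfolding set_integrable_def by (intro borel_integrable_compact assms) auto

lemma expectation_fst: "expectation fst = 1/2"
proof -
  have "(LINT t:{0..1}|lborel. prob {z \<in> space (copula_measure C). fst z \<le> t}) =
      (LINT t:{0..1}|lborel. t)"
    by (rule set_lebesgue_integral_cong) (auto simp: prob_fst_le)
  then show ?thesis
    by (subst expectation_eq_one_minus_cdf_integral)
      (auto simp: LINT_identity_unit space_copula_measure)
qed

lemma expectation_min:
  "expectation (\<lambda>z. min (fst z) (snd z)) = (LINT t:{0..1}|lborel. C t t)"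
proof -
  have "(LINT t:{0..1}|lborel. prob {z \<in> space (copula_measure C). min (fst z) (snd z) \<le> t}) =
      (LINT t:{0..1}|lborel. 2 * t - C t t)"
    by (rule set_lebesgue_integral_cong) (auto simp: prob_min_le)
  also have "\<dots> = (LINT t:{0..1}|lborel. 2 * t) - (LINT t:{0..1}|lborel. C t t)"
    by (intro set_integral_diff set_integrable_unit continuous_on_diagonal continuous_intros)
  also have "(LINT t:{0..1}|lborel. 2 * t) = (1 :: real)"
    using LINT_identity_unit by simp
  finally show ?thesis
    by (subst expectation_eq_one_minus_cdf_integral) (auto simp: space_copula_measure)
qed

lemma expectation_min_flip:
  "expectation (\<lambda>z. min (fst z) (1 - snd z)) = 1/2 - (LINT t:{0..1}|lborel. C t (1 - t))"
proof -
  have "(LINT t:{0..1}|lborel. prob {z \<in> space (copula_measure C). min (fst z) (1 - snd z) \<le> t}) =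
      (LINT t:{0..1}|lborel. t + C t (1 - t))"
    by (rule set_lebesgue_integral_cong) (auto simp: prob_min_flip_le)
  also have "\<dots> = (LINT t:{0..1}|lborel. t) + (LINT t:{0..1}|lborel. C t (1 - t))"
    by (intro set_integral_add set_integrable_unit continuous_on_antidiagonal continuous_intros)
  finally show ?thesis
    by (subst expectation_eq_one_minus_cdf_integral)
      (auto simp: space_copula_measure LINT_identity_unit)
qed

text \<open>The integrand is the cdf of \<open>min U V\<close> evaluated at \<open>min U V\<close>
  itself.\<close>

lemma expectation_cdf_min:
  "expectation (\<lambda>z. 2 * min (fst z) (snd z) - C (min (fst z) (snd z)) (min (fst z) (snd z))) = 1/2"
  by (rule expectation_probability_integral_transform[where X = "\<lambda>z. min (fst z) (snd z)"])
    (auto simp: space_copula_measure prob_min_le[simplified space_copula_measure] zero_left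
      intro!: continuous_intros continuous_on_diagonal)

lemma expectation_cdf_min_flip:
  "expectation (\<lambda>z. min (fst z) (1 - snd z) +
    C (min (fst z) (1 - snd z)) (1 - min (fst z) (1 - snd z))) = 1/2"
  by (rule expectation_probability_integral_transform[where X = "\<lambda>z. min (fst z) (1 - snd z)"])
    (auto simp: space_copula_measure prob_min_flip_le[simplified space_copula_measure] zero_left
      intro!: continuous_intros continuous_on_antidiagonal)

text \<open>The first two are the Frechet-Hoeffding bounds, as
  \<open>u - min u (1 - v) = max 0 (u + v - 1)\<close>. The third is monotonicity. For the last, put
  \<open>n = min u (1 - v)\<close>: the antidiagonal point \<open>(n, 1 - n)\<close> is reached from
  \<open>(u, v)\<close> by raising \<open>v\<close> to \<open>1 - u\<close> if
  \<open>u \<le> 1 - v\<close>, and otherwise by lowering \<open>u\<close> to \<open>1 - v\<close>,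
  which costs at most \<open>u - n\<close>.\<close>

lemma
  assumes u: "u \<in> {0..1}" and v: "v \<in> {0..1}"
  shows le_min: "C u v \<le> min u v"
    and ge_diff_min_flip: "u - min u (1 - v) \<le> C u v"
    and ge_diagonal_min: "C (min u v) (min u v) \<le> C u v"
    and le_antidiagonal_min_flip:
      "C u v \<le> u - min u (1 - v) + C (min u (1 - v)) (1 - min u (1 - v))"
proof -
  show "C u v \<le> min u v"
    using mono_right[OF u v, of 1] mono_left[OF u _ v, of 1] u v
    by (simp add: one_right one_left)
  show "u - min u (1 - v) \<le> C u v"
    using mono_left[OF u _ v, of 1] range[OF u v] u v by (auto simp: one_left)
  have m: "min u v \<in> {0..1}" using u v by auto
  show "C (min u v) (min u v) \<le> C u v"
    using mono_left(1)[OF m u m] mono_right(1)[OF u m v] by simp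
  show "C u v \<le> u - min u (1 - v) + C (min u (1 - v)) (1 - min u (1 - v))"
  proof (cases "u \<le> 1 - v")
    case True
    then show ?thesis using mono_right(1)[OF u v, of "1 - u"] u by (simp add: min_def)
  next
    case False
    then show ?thesis using mono_left(2)[OF _ u v, of "1 - v"] v by (simp add: min_def)
  qed
qed

lemma kendall_integral_bounds:
  fixes T a b :: real
  defines "T \<equiv> LINT (u, v)|copula_measure C. C u v"
    and "a \<equiv> LINT t:{0..1}|lborel. C t t"
    and "b \<equiv> LINT t:{0..1}|lborel. C t (1 - t)"
  shows "T \<le> a" "b \<le> T" "2 * a - 1/2 \<le> T" "T \<le> 2 * b"
proof -
  let ?m = "\<lambda>z :: real \<times> real. min (fst z) (snd z)"
  let ?n = "\<lambda>z :: real \<times> real. min (fst z) (1 - snd z)"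
  have C: "integrable (copula_measure C) (\<lambda>(u, v). C u v)"
    by (rule integrable_copula_measure[OF continuous_on_copula])
  have U: "integrable (copula_measure C) fst"
    and m: "integrable (copula_measure C) ?m"
    and n: "integrable (copula_measure C) ?n"
    by (intro integrable_copula_measure continuous_intros)+
  have Cm: "integrable (copula_measure C) (\<lambda>z. C (?m z) (?m z))"
    and Cn: "integrable (copula_measure C) (\<lambda>z. C (?n z) (1 - ?n z))"
    by (intro integrable_copula_measure continuous_on_copula_compose continuous_intros; auto)+
  \<comment> \<open>With \<open>X = min U V\<close> and \<open>E X = a\<close>, the transform
    identity reads \<open>2 * a - E C(X, X) = 1/2\<close>.\<close>
  have ECm: "expectation (\<lambda>z. C (?m z) (?m z)) = 2 * a - 1/2"
    using expectation_cdf_min expectation_min m Cm by (simp add: a_def)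
  \<comment> \<open>With \<open>Y = min U (1 - V)\<close> and \<open>E Y = 1/2 - b\<close>, the
    transform identity reads \<open>(1/2 - b) + E C(Y, 1 - Y) = 1/2\<close>.\<close>
  have ECn: "expectation (\<lambda>z. C (?n z) (1 - ?n z)) = b"
    using expectation_cdf_min_flip expectation_min_flip n Cn by (simp add: b_def)
  have "T \<le> expectation ?m"
    unfolding T_def using le_min
    by (intro integral_mono C m) (auto simp: space_copula_measure)
  then show "T \<le> a" by (simp add: expectation_min a_def)
  have "expectation (\<lambda>z. fst z - ?n z) \<le> T"
    unfolding T_def using ge_diff_min_flip
    by (intro integral_mono C n U Bochner_Integration.integrable_diff) (auto simp: space_copula_measure)
  then show "b \<le> T" using U n by (simp add: expectation_fst expectation_min_flip b_def)
  have "expectation (\<lambda>z. C (?m z) (?m z)) \<le> T"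
    unfolding T_def using ge_diagonal_min
    by (intro integral_mono C Cm) (auto simp: space_copula_measure)
  then show "2 * a - 1/2 \<le> T" by (simp add: ECm)
  have "T \<le> expectation (\<lambda>z. (fst z - ?n z) + C (?n z) (1 - ?n z))"
    unfolding T_def using le_antidiagonal_min_flip
    by (intro integral_mono C n U Cn Bochner_Integration.integrable_diff Bochner_Integration.integrable_add)
      (auto simp: space_copula_measure)
  \<comment> \<open>The three means add up to \<open>1/2 - (1/2 - b) + b\<close>.\<close>
  also have "\<dots> = 2 * b"
    using U n Cn by (simp add: expectation_fst expectation_min_flip ECn b_def)
  finally show "T \<le> 2 * b" .
qed

end

theorem lemma4p1:
  fixes C :: "real \<Rightarrow> real \<Rightarrow> real"
  assumes "copula C"
  shows "max (4/3 * spearman_footrule C - 1/3)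
             (- (2/3) * spearman_footrule C + gini_gamma C - 1/3) \<le> kendall_tau C \<and>
         kendall_tau C \<le> min (2/3 * spearman_footrule C + 1/3)
             (- (4/3) * spearman_footrule C + 2 * gini_gamma C + 1/3)"
proof -
  interpret copula_function C by unfold_locales (rule assms)
  \<comment> \<open>With \<open>\<tau> = 4T - 1\<close>, \<open>\<phi> = 6a - 2\<close> and
    \<open>\<gamma> = 4a + 4b - 2\<close>, the lower bounds become \<open>8a - 3\<close> and
    \<open>4b - 1\<close>, the upper ones \<open>4a - 1\<close> and \<open>8b - 1\<close>. These are
    the four estimates of \<open>T\<close> under the map \<open>x \<mapsto> 4x - 1\<close>.\<close>
  show ?thesis
    using kendall_integral_bounds
    unfolding kendall_tau_def gini_gamma_def spearman_footrule_def
    by (simp add: diff_divide_distrib)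
qed

end
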